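(* There exist positive constants $C$ and $n_0$ such that for every non-decreasing function $f:\mathbb{N}\to\mathbb{N}$ with $n\leqslant f(n)\leqslant R(K_n)$ for all $n\in\mathbb{N}$, there exists a sequence of connected graphs $(G_n)_{n\in\mathbb{N}}$ such that for all $n\geqslant n_0$, $|V(G_n)|=n$ and $$f(n)\leqslant R(G_n)\leqslant C f(n).$$
   Context: For a graph $G$, the (two-colour) Ramsey number $R(G)$ is the smallest integer $N$ such that every colouring of the edges of the complete graph $K_N$ with two colours contains a copy of $G$ all of whose edges have the same colour. $K_n$ denotes the complete graph on $n$ vertices. *)

theory Defs
  imports Complex_Main
begin

text \<open>A finite simple graph on natural-number vertices: vertex set V and a set E of
  2-element subsets of V (the edges).\<close>
type_synonym graph = "nat set \<times> nat set set"

definition verts :: "graph \<Rightarrow> nat set" where "verts G = fst G"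
definition edges :: "graph \<Rightarrow> nat set set" where "edges G = snd G"

definition is_graph :: "graph \<Rightarrow> bool" where
  "is_graph G \<longleftrightarrow> finite (verts G) \<and>
     (\<forall>e\<in>edges G. \<exists>x y. x \<noteq> y \<and> e = {x, y} \<and> x \<in> verts G \<and> y \<in> verts G)"

definition adj_rel :: "graph \<Rightarrow> (nat \<times> nat) set" where
  "adj_rel G = {(x, y). {x, y} \<in> edges G}"

definition connected_graph :: "graph \<Rightarrow> bool" where
  "connected_graph G \<longleftrightarrow> is_graph G \<and> verts G \<noteq> {} \<and>
     (\<forall>x\<in>verts G. \<forall>y\<in>verts G. (x, y) \<in> (adj_rel G)\<^sup>*)"

text \<open>Complete graph K_n on vertex set {0..<n}.\<close>
definition complete_graph :: "nat \<Rightarrow> graph" where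
  "complete_graph n = ({..<n}, {e. \<exists>x y. x < n \<and> y < n \<and> x \<noteq> y \<and> e = {x, y}})"

text \<open>A red/blue colouring of the edges of K_N is a map from 2-subsets to bool
  (values on other sets are irrelevant). A monochromatic copy of G is an injective
  map of V(G) into {0..<N} sending all edges of G to edges of one colour.\<close>
definition has_mono_copy :: "nat \<Rightarrow> graph \<Rightarrow> (nat set \<Rightarrow> bool) \<Rightarrow> bool" where
  "has_mono_copy N G c \<longleftrightarrow>
     (\<exists>\<phi> col. inj_on \<phi> (verts G) \<and> \<phi> ` verts G \<subseteq> {..<N} \<and>
        (\<forall>e\<in>edges G. c (\<phi> ` e) = col))"

definition ramsey_number :: "graph \<Rightarrow> nat" where
  "ramsey_number G = (LEAST N. \<forall>c. has_mono_copy N G c)"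

end

theory Submission
  imports Defs "HOL-Library.FuncSet"
begin

text \<open>Let G(n,k) be a k-clique one of whose vertices is joined to all other of the n vertices.
  Then max(R(K_k), (k-1)(n-1)+1) \<le> R(G(n,k)) \<le> R(K_k) + 2nk: for the upper bound, a vertex of a
  monochromatic k-clique has degree below n in the colour of that clique, so the many vertices lying
  in red (say) k-cliques contain a blue k-clique, whose vertices then have too small a total degree.
  As R(K_(k+1)) \<le> 71 R(K_k), consecutive values of R(G(n,k)), k = 1,...,n, stay within
  a constant factor, and they lead from O(n) to R(K_n); so the least k with R(G(n,k)) \<ge> f(n) works.

  The bound on R(K_(k+1)) follows Erdos and Szemeredi: a colouring without monochromatic K_(k+1)
  has a large vertex set in which, say, all blue degrees are below m = R(K_k). If W is a maximum red
  clique there, with fewer than k vertices, then most vertices have few blue neighbours in W, and by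
  pigeonhole many have the same blue neighbourhood B. Since m is exponential in k, these contain a
  red clique larger than B, which replaces B in W.\<close>

section \<open>Cliques and neighbourhoods in one colour\<close>

text \<open>The colour is a parameter, so that each argument is stated once and reaches the other
  colour through \<open>\<not> b\<close>. Sets with at most one element are homogeneous in both
  colours.\<close>

definition homogeneous :: "(nat set \<Rightarrow> bool) \<Rightarrow> bool \<Rightarrow> nat set \<Rightarrow> bool" where
  "homogeneous c b A \<longleftrightarrow> (\<forall>x\<in>A. \<forall>y\<in>A. x \<noteq> y \<longrightarrow> c {x, y} = b)"

text \<open>\<open>x\<close> need not lie in \<open>V\<close>, so the neighbours that a vertex has
  in a clique not containing it are covered too.\<close>

definition nbrs :: "(nat set \<Rightarrow> bool) \<Rightarrow> bool \<Rightarrow> nat set \<Rightarrow> nat \<Rightarrow> nat set" where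
  "nbrs c b V x = {y \<in> V. y \<noteq> x \<and> c {x, y} = b}"

lemma nbrs_subset: "nbrs c b V x \<subseteq> V - {x}"
  by (auto simp: nbrs_def)

lemma finite_nbrs: "finite V \<Longrightarrow> finite (nbrs c b V x)"
  by (auto simp: nbrs_def)

lemma homogeneous_subset: "homogeneous c b A \<Longrightarrow> B \<subseteq> A \<Longrightarrow> homogeneous c b B"
  by (auto simp: homogeneous_def)

lemma homogeneous_insert:
  "homogeneous c b A \<Longrightarrow> A \<subseteq> nbrs c b V x \<Longrightarrow> homogeneous c b (insert x A)"
  unfolding homogeneous_def nbrs_def by (auto simp: insert_commute)

lemma homogeneous_Un:
  assumes "homogeneous c b A" "homogeneous c b B"
    and "\<And>x y. x \<in> A \<Longrightarrow> y \<in> B \<Longrightarrow> x \<noteq> y \<Longrightarrow> c {x, y} = b"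
  shows "homogeneous c b (A \<union> B)"
  unfolding homogeneous_def
proof (intro ballI impI)
  fix x y assume "x \<in> A \<union> B" "y \<in> A \<union> B" "x \<noteq> y"
  then show "c {x, y} = b"
    using assms(1,2) assms(3)[of x y] assms(3)[of y x]
    unfolding homogeneous_def by (auto simp: insert_commute[of y x])
qed

lemma extend_clique:
  assumes "finite V" "v \<in> V" "A \<subseteq> nbrs c b V v" "card A = k" "homogeneous c b A"
  shows "\<exists>A\<subseteq>V. card A = Suc k \<and> homogeneous c b A"
proof (intro exI conjI)
  have "finite A" "v \<notin> A"
    using assms(1,3) finite_subset[OF _ finite_nbrs] by (auto simp: nbrs_def)
  then show "card (insert v A) = Suc k" using assms(4) by simp
  show "insert v A \<subseteq> V" using assms(2,3) nbrs_subset by fastforce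
  show "homogeneous c b (insert v A)" by (rule homogeneous_insert[OF assms(5,3)])
qed

lemma card_nbrs_both:
  assumes "finite V" "v \<in> V"
  shows "card (nbrs c b V v) + card (nbrs c (\<not> b) V v) = card V - 1"
proof -
  have "nbrs c b V v \<union> nbrs c (\<not> b) V v = V - {v}"
    by (auto simp: nbrs_def)
  moreover have "nbrs c b V v \<inter> nbrs c (\<not> b) V v = {}"
    by (auto simp: nbrs_def)
  ultimately show ?thesis
    using card_Un_disjoint[OF finite_nbrs[OF assms(1)] finite_nbrs[OF assms(1)], of c b v c "\<not> b" v] assms
    by simp
qed

section \<open>Ramsey numbers of complete graphs: the binomial upper bound\<close>

text \<open>The Erdos-Szekeres recursion: one of the two neighbourhoods of a vertex \<open>v\<close>
  is large enough for the induction hypothesis, and \<open>v\<close> extends a clique of the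
  matching colour. Asking for \<open>Suc a\<close> and \<open>Suc b\<close> vertices makes the bound
  a plain binomial coefficient and the base case a single vertex.\<close>

lemma ramsey_choose:
  assumes "finite V" "card V \<ge> (a + b) choose a"
  shows "(\<exists>A\<subseteq>V. card A = Suc a \<and> homogeneous c col A) \<or>
         (\<exists>A\<subseteq>V. card A = Suc b \<and> homogeneous c (\<not> col) A)"
  using assms
proof (induction "a + b" arbitrary: a b V rule: less_induct)
  case less
  have "(a + b) choose a > 0" by simp
  then have "card V > 0" using less.prems by linarith
  then obtain v where v: "v \<in> V" by fastforce
  show ?case
  proof (cases "a = 0 \<or> b = 0")
    case True
    then show ?thesis using v by (auto intro!: exI[of _ "{v}"] simp: homogeneous_def)
  next
    case False
    then obtain a' b' where ab: "a = Suc a'" "b = Suc b'" by (meson not0_implies_Suc)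
    have "(a + b) choose a = ((a' + b) choose a') + ((a + b') choose a)"
      using ab by (simp add: add.commute)
    \<comment> \<open>If both neighbourhoods fell short of their Pascal term, each by at least one,
      they would have at most \<open>card V - 2\<close> vertices together.\<close>
    then consider "card (nbrs c col V v) \<ge> (a' + b) choose a'"
      | "card (nbrs c (\<not> col) V v) \<ge> (a + b') choose a"
      using less.prems card_nbrs_both[OF less.prems(1) v, of c col] by linarith
    then show ?thesis
    proof cases
      case 1
      have "a' + b < a + b" using ab by simp
      from less.hyps[OF this finite_nbrs[OF less.prems(1)] 1]
      consider A where "A \<subseteq> nbrs c col V v" "card A = a" "homogeneous c col A"
        | A where "A \<subseteq> nbrs c col V v" "card A = Suc b" "homogeneous c (\<not> col) A"
        using ab by auto
      then show ?thesis
      proof cases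
        case 1
        from extend_clique[OF less.prems(1) v 1] show ?thesis by (rule disjI1)
      next
        case 2 then show ?thesis using nbrs_subset[of c col V v] by blast
      qed
    next
      case 2
      have "a + b' < a + b" using ab by simp
      from less.hyps[OF this finite_nbrs[OF less.prems(1)] 2]
      consider A where "A \<subseteq> nbrs c (\<not> col) V v" "card A = b" "homogeneous c (\<not> col) A"
        | A where "A \<subseteq> nbrs c (\<not> col) V v" "card A = Suc a" "homogeneous c col A"
        using ab by auto
      then show ?thesis
      proof cases
        case 1
        from extend_clique[OF less.prems(1) v 1] show ?thesis by (rule disjI2)
      next
        case 2 then show ?thesis using nbrs_subset[of c "\<not> col" V v] by blast
      qed
    qed
  qed
qed

text \<open>Allows cliques to be handled as vertex sets instead of embeddings.\<close>

lemma has_mono_copy_complete_iff: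
  "has_mono_copy N (complete_graph k) c \<longleftrightarrow>
     (\<exists>A col. A \<subseteq> {..<N} \<and> card A = k \<and> homogeneous c col A)"
proof
  assume "has_mono_copy N (complete_graph k) c"
  then obtain \<phi> col where p: "inj_on \<phi> {..<k}" "\<phi> ` {..<k} \<subseteq> {..<N}"
    "\<And>e. e \<in> edges (complete_graph k) \<Longrightarrow> c (\<phi> ` e) = col"
    unfolding has_mono_copy_def by (auto simp: verts_def complete_graph_def)
  have "homogeneous c col (\<phi> ` {..<k})"
    unfolding homogeneous_def
  proof (intro ballI impI)
    fix x y assume "x \<in> \<phi> ` {..<k}" "y \<in> \<phi> ` {..<k}" "x \<noteq> y"
    then obtain i j where "i < k" "j < k" "i \<noteq> j" "x = \<phi> i" "y = \<phi> j" by auto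
    then show "c {x, y} = col" using p(3)[of "{i, j}"]
      by (auto simp: edges_def complete_graph_def)
  qed
  then show "\<exists>A col. A \<subseteq> {..<N} \<and> card A = k \<and> homogeneous c col A"
    using p card_image[OF p(1)] by (metis card_lessThan)
next
  assume "\<exists>A col. A \<subseteq> {..<N} \<and> card A = k \<and> homogeneous c col A"
  then obtain A col where A: "A \<subseteq> {..<N}" "card A = k" "homogeneous c col A" by blast
  have "finite A" using A(1) finite_subset by blast
  then obtain \<phi> where p: "bij_betw \<phi> {..<k} A"
    using A(2) finite_same_card_bij[of "{..<k}" A] by auto
  then have "inj_on \<phi> {..<k}" "\<phi> ` {..<k} = A" by (auto simp: bij_betw_def)
  moreover have "c (\<phi> ` e) = col" if e: "e \<in> edges (complete_graph k)" for e
  proof -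
    obtain x y where "x < k" "y < k" "x \<noteq> y" "e = {x, y}"
      using e by (auto simp: edges_def complete_graph_def)
    then show ?thesis using A(3) p
      by (auto simp: homogeneous_def bij_betw_def inj_on_def)
  qed
  ultimately show "has_mono_copy N (complete_graph k) c"
    unfolding has_mono_copy_def using A(1)
    by (auto simp: verts_def complete_graph_def)
qed

text \<open>\<open>LEAST\<close> carries information only if some \<open>N\<close> works; any upper
  bound, however crude, supplies one.\<close>

lemma ramsey_number_has_mono_copy:
  assumes "\<And>c. has_mono_copy N G c"
  shows "has_mono_copy (ramsey_number G) G c"
  unfolding ramsey_number_def using LeastI[of "\<lambda>N. \<forall>c. has_mono_copy N G c" N] assms by blast

lemma ramsey_number_le:
  assumes "\<And>c. has_mono_copy N G c"
  shows "ramsey_number G \<le> N"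
  unfolding ramsey_number_def using assms by (intro Least_le allI)

lemma complete_graph_ramsey:
  "has_mono_copy (ramsey_number (complete_graph k)) (complete_graph k) c"
proof (rule ramsey_number_has_mono_copy)
  fix c
  show "has_mono_copy ((k + k) choose k) (complete_graph k) c"
    unfolding has_mono_copy_complete_iff
  proof -
    obtain A col where A: "A \<subseteq> {..<(k + k) choose k}" "card A = Suc k" "homogeneous c col A"
      using ramsey_choose[OF finite_lessThan, of k k "(k + k) choose k" c True]
      unfolding card_lessThan by blast
    obtain B where "B \<subseteq> A" "card B = k"
      using A(2) by (metis le_SucI obtain_subset_with_card_n order_refl)
    then show "\<exists>A col. A \<subseteq> {..<k + k choose k} \<and> card A = k \<and> homogeneous c col A"
      using A homogeneous_subset by blast
  qed
qed

text \<open>Pulling the colouring back along a bijection makes the Ramsey number applicable inside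
  any large vertex set, such as a neighbourhood.\<close>

lemma complete_graph_ramsey_set:
  assumes "finite V" "card V \<ge> ramsey_number (complete_graph k)"
  shows "\<exists>A col. A \<subseteq> V \<and> card A = k \<and> homogeneous c col A"
proof -
  define N where "N = ramsey_number (complete_graph k)"
  obtain V' where V': "V' \<subseteq> V" "card V' = N" "finite V'"
    using assms obtain_subset_with_card_n N_def by metis
  then obtain g where g: "bij_betw g {..<N} V'"
    using finite_same_card_bij[of "{..<N}" V'] by auto
  obtain A col where A: "A \<subseteq> {..<N}" "card A = k" "homogeneous (\<lambda>e. c (g ` e)) col A"
    using complete_graph_ramsey[of k "\<lambda>e. c (g ` e)"]
    unfolding has_mono_copy_complete_iff N_def by blast
  have "inj_on g A" using g A(1) by (meson bij_betw_def inj_on_subset)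
  then have "card (g ` A) = k" using A(2) by (simp add: card_image)
  moreover have "g ` A \<subseteq> V" using g A(1) V'(1) by (auto simp: bij_betw_def)
  moreover have "homogeneous c col (g ` A)" using A(3) by (auto simp: homogeneous_def)
  ultimately show ?thesis by blast
qed

lemma le_ramsey_number_complete: "k \<le> ramsey_number (complete_graph k)"
proof -
  obtain A col where "A \<subseteq> {..<ramsey_number (complete_graph k)}" "card A = k"
    using complete_graph_ramsey[of k "\<lambda>_. True"] unfolding has_mono_copy_complete_iff by blast
  then show ?thesis using card_mono[of "{..<ramsey_number (complete_graph k)}" A] by auto
qed

section \<open>Exponential lower bound by counting colourings\<close>

text \<open>Counting argument of Erdos: there are at most N^k vertex sets of size \<open>k\<close>,
  and each is monochromatic in at most a 2^(1-q) fraction of the colourings, where q = k choose 2.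
  The hypothesis is N < 2^(k/2)/2, squared to avoid roots.\<close>

lemma exists_colouring_no_clique:
  assumes "1 \<le> k" "4 * N\<^sup>2 < 2 ^ k"
  shows "\<exists>c. \<not> has_mono_copy N (complete_graph k) c"
proof (cases "k \<le> N")
  case False
  have "\<not> has_mono_copy N (complete_graph k) c" for c
  proof
    assume "has_mono_copy N (complete_graph k) c"
    then obtain A where "A \<subseteq> {..<N}" "card A = k"
      unfolding has_mono_copy_complete_iff by blast
    then show False using False card_mono[of "{..<N}" A] by simp
  qed
  then show ?thesis by blast
next
  case True
  define E where "E = {e. e \<subseteq> {..<N} \<and> card e = 2}"
  define F where "F A = {e. e \<subseteq> A \<and> card e = 2}" for A :: "nat set"
  define \<K> where "\<K> = {A. A \<subseteq> {..<N} \<and> card A = k}"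
  \<comment> \<open>A colouring is identified with the set \<open>X\<close> of its edges of colour
    \<open>True\<close>. The set \<open>A\<close> is homogeneous exactly when \<open>X\<close>
    misses \<open>F A\<close> or contains it, whence the two families.\<close>
  define bad where "bad A = Pow (E - F A) \<union> (\<lambda>X. X \<union> F A) ` Pow (E - F A)" for A
  have finE: "finite E" unfolding E_def by simp
  have finK: "finite \<K>" unfolding \<K>_def by simp
  have cardK: "card \<K> \<le> N ^ k"
    unfolding \<K>_def using n_subsets[of "{..<N}" k] binomial_le_pow[OF True] by simp
  define q where "q = k choose 2"
  have F: "F A \<subseteq> E" "card (F A) = q" if "A \<in> \<K>" for A
  proof -
    have "finite A" using that finite_subset unfolding \<K>_def by blast
    then show "card (F A) = q" using n_subsets[of A 2] that unfolding F_def q_def \<K>_def by simp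
    show "F A \<subseteq> E" using that unfolding F_def E_def \<K>_def by auto
  qed
  have q2: "2 * q + k = k * k"
    using assms(1) unfolding q_def choose_two
    by (cases k) (auto simp: algebra_simps)
  have N1: "1 \<le> N" using True assms(1) by simp
  have k2: "2 \<le> k"
  proof (rule ccontr)
    assume "\<not> 2 \<le> k"
    then have "k = 1" using assms(1) by simp
    then have "4 * N\<^sup>2 < 2" using assms(2) by simp
    then have "N\<^sup>2 = 0" by linarith
    with N1 show False by simp
  qed
  \<comment> \<open>The k-th power of the hypothesis is 4^k N^(2k) < 2^(2q+k), since k^2 = 2q + k.
    Cancelling 2^k and using 4 \<le> 2^k leaves 4 N^(2k) < 2^(2q), the square of the claim.\<close>
  have small: "N ^ k * 2 < 2 ^ q"
  proof -
    have "(4 * N\<^sup>2) ^ k < (2 ^ k) ^ k"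
      using assms by (intro power_strict_mono) auto
    also have "(2 ^ k) ^ k = (2::nat) ^ k * (2 ^ q)\<^sup>2"
      by (simp add: q2[symmetric] flip: power_mult power_add)
    also have "(4 * N\<^sup>2) ^ k = 2 ^ k * (2 ^ k * (N ^ k)\<^sup>2)"
    proof -
      have "(4::nat) ^ k = 2 ^ k * 2 ^ k" by (simp flip: power_mult_distrib)
      then show ?thesis by (simp add: power_mult_distrib power_mult[symmetric] mult.commute)
    qed
    finally have "2 ^ k * (N ^ k)\<^sup>2 < (2 ^ q)\<^sup>2" by simp
    moreover have "(2::nat)\<^sup>2 \<le> 2 ^ k" using k2 by (intro power_increasing) auto
    then have "4 * (N ^ k)\<^sup>2 \<le> 2 ^ k * (N ^ k)\<^sup>2" by (intro mult_right_mono) auto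
    ultimately have "4 * (N ^ k)\<^sup>2 < (2 ^ q)\<^sup>2" by (rule le_less_trans[rotated])
    then have "(N ^ k * 2)\<^sup>2 < (2 ^ q)\<^sup>2" by (simp add: power_mult_distrib mult.commute)
    then show ?thesis by (rule power2_less_imp_less) simp
  qed
  have badcard: "card (bad A) \<le> 2 * 2 ^ (card E - q)" if "A \<in> \<K>" for A
  proof -
    have "card (Pow (E - F A)) = 2 ^ (card E - q)"
      using F[OF that] finE by (simp add: card_Pow card_Diff_subset finite_subset)
    moreover have "card ((\<lambda>X. X \<union> F A) ` Pow (E - F A)) \<le> card (Pow (E - F A))"
      using finE by (intro card_image_le) simp
    ultimately show ?thesis unfolding bad_def
      using card_Un_le[of "Pow (E - F A)" "(\<lambda>X. X \<union> F A) ` Pow (E - F A)"] by linarith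
  qed
  have "card (\<Union>A\<in>\<K>. bad A) < card (Pow E)"
  proof (cases "\<K> = {}")
    case False
    then obtain A0 where "A0 \<in> \<K>" by blast
    then have qE: "q \<le> card E" using F finE card_mono by metis
    have "card (\<Union>A\<in>\<K>. bad A) \<le> (\<Sum>A\<in>\<K>. card (bad A))" by (rule card_UN_le[OF finK])
    also have "\<dots> \<le> (\<Sum>A\<in>\<K>. 2 * 2 ^ (card E - q))" by (rule sum_mono[OF badcard])
    also have "\<dots> \<le> N ^ k * 2 * 2 ^ (card E - q)" using cardK by simp
    also have "\<dots> < 2 ^ q * 2 ^ (card E - q)" using small by simp
    also have "\<dots> = 2 ^ card E" using qE by (simp flip: power_add)
    finally show ?thesis using finE by (simp add: card_Pow)
  qed (use finE in \<open>simp add: card_Pow\<close>)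
  moreover have "finite (\<Union>A\<in>\<K>. bad A)" using finK finE unfolding bad_def by simp
  ultimately have "\<not> Pow E \<subseteq> (\<Union>A\<in>\<K>. bad A)" using card_mono leD by blast
  then obtain X where X: "X \<subseteq> E" "\<And>A. A \<in> \<K> \<Longrightarrow> X \<notin> bad A" by blast
  have "\<not> has_mono_copy N (complete_graph k) (\<lambda>e. e \<in> X)"
  proof
    assume "has_mono_copy N (complete_graph k) (\<lambda>e. e \<in> X)"
    then obtain A col where A: "A \<in> \<K>" "homogeneous (\<lambda>e. e \<in> X) col A"
      unfolding has_mono_copy_complete_iff \<K>_def by blast
    have hom: "(e \<in> X) = col" if "e \<in> F A" for e
    proof -
      from that obtain x y where "e = {x, y}" "x \<noteq> y" "x \<in> A" "y \<in> A"
        unfolding F_def by (auto simp: card_2_iff)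
      then show ?thesis using A(2) unfolding homogeneous_def by blast
    qed
    show False
    proof (cases col)
      case True
      then have "X = (X - F A) \<union> F A" using hom by auto
      then have "X \<in> bad A" using X(1) unfolding bad_def by blast
      then show False using X(2) A(1) by blast
    next
      case False
      then have "X \<in> bad A" using X(1) hom unfolding bad_def by blast
      then show False using X(2) A(1) by blast
    qed
  qed
  then show ?thesis by blast
qed

lemma ramsey_number_complete_lower:
  assumes "1 \<le> k"
  shows "2 ^ k \<le> 4 * (ramsey_number (complete_graph k))\<^sup>2"
  using exists_colouring_no_clique[OF assms] complete_graph_ramsey[of k] not_le by blast

section \<open>Numerical estimates for the pigeonhole step\<close>

text \<open>Each set \<open>B\<close> that is counted has weight 16^(j - card B) \<ge> 1. Extended
  to all subsets of \<open>W\<close>, the sum of the weights factors over the elements of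
  \<open>W\<close>.\<close>

lemma card_small_subsets_le:
  assumes "finite W"
  shows "real (card {B. B \<subseteq> W \<and> card B \<le> j}) \<le> 16 ^ j * (17/16) ^ card W"
proof -
  have fin: "finite {B. B \<subseteq> W \<and> card B \<le> j}" using assms by simp
  have "real (card {B. B \<subseteq> W \<and> card B \<le> j}) = (\<Sum>B | B \<subseteq> W \<and> card B \<le> j. 1)" by simp
  also have "\<dots> \<le> (\<Sum>B | B \<subseteq> W \<and> card B \<le> j. 16 ^ j * (1/16) ^ card B)"
  proof (rule sum_mono)
    fix B assume "B \<in> {B. B \<subseteq> W \<and> card B \<le> j}"
    then have "(16::real) ^ card B \<le> 16 ^ j" by (intro power_increasing) auto
    then show "(1::real) \<le> 16 ^ j * (1/16) ^ card B" by (simp add: power_divide)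
  qed
  also have "\<dots> \<le> (\<Sum>B\<in>Pow W. 16 ^ j * (1/16) ^ card B)"
    using assms by (intro sum_mono2) auto
  also have "\<dots> = 16 ^ j * (\<Prod>x\<in>W. 1/16 + 1)"
    using prod_add[OF assms, of "\<lambda>_. 1/16 :: real" "\<lambda>_. 1"] by (simp add: sum_distrib_left)
  finally show ?thesis by simp
qed

text \<open>The binomial theorem for (1/17 + 16/17)^(j+k).\<close>
lemma choose_le_pow_mult_pow: "real ((j + k) choose j) \<le> 17 ^ j * (17/16) ^ k"
proof -
  have "real ((j + k) choose j) * (1/17) ^ j * (16/17) ^ (j + k - j) \<le>
        (\<Sum>i\<le>j + k. real ((j + k) choose i) * (1/17) ^ i * (16/17) ^ (j + k - i))"
    by (rule member_le_sum[where f = "\<lambda>i. real ((j + k) choose i) * (1/17) ^ i * (16/17) ^ (j + k - i)"]) auto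
  also have "\<dots> = (1/17 + 16/17) ^ (j + k)" by (rule binomial_ring[symmetric])
  finally have "real ((j + k) choose j) * (16 ^ k / (17 ^ j * 17 ^ k)) \<le> 1"
    by (simp add: power_divide)
  then show ?thesis by (simp add: power_divide field_simps)
qed

text \<open>In the exchange argument the two factors are the number of classes and the class size
  that forces a clique. With 2^k \<le> 4 R(K_k)^2 their product is at most 2 R(K_k).\<close>

lemma small_subsets_choose_bound:
  assumes "finite W" "card W \<le> k" "32 * j \<le> k"
  shows "(card {B. B \<subseteq> W \<and> card B \<le> j} * ((j + k) choose j))\<^sup>2 \<le> 2 ^ k"
proof -
  define r where "r = k - 32 * j"
  have k: "k = 32 * j + r" using assms(3) r_def by simp
  have split: "((a ^ j * q ^ k) * (d ^ j * q ^ k))\<^sup>2 = ((a * d)\<^sup>2 * q ^ 128) ^ j * (q ^ 4) ^ r"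
    for a d q :: real
  proof -
    have "((a ^ j * q ^ k) * (d ^ j * q ^ k))\<^sup>2 = ((a * d)\<^sup>2) ^ j * q ^ (4 * k)"
      by (simp add: power_mult_distrib power_add[symmetric] power_mult[symmetric] mult.commute mult.left_commute)
    also have "q ^ (4 * k) = (q ^ 128) ^ j * (q ^ 4) ^ r"
      by (simp add: k power_add flip: power_mult)
    finally show ?thesis by (simp add: power_mult_distrib)
  qed
  have "real (card {B. B \<subseteq> W \<and> card B \<le> j}) \<le> 16 ^ j * (17/16) ^ card W"
    by (rule card_small_subsets_le[OF assms(1)])
  also have "\<dots> \<le> 16 ^ j * (17/16) ^ k"
    using assms(2) by (intro mult_left_mono power_increasing) auto
  finally have "real (card {B. B \<subseteq> W \<and> card B \<le> j}) * real ((j + k) choose j)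
      \<le> (16 ^ j * (17/16) ^ k) * (17 ^ j * (17/16) ^ k)"
    by (intro mult_mono choose_le_pow_mult_pow) auto
  then have "(real (card {B. B \<subseteq> W \<and> card B \<le> j}) * real ((j + k) choose j))\<^sup>2
      \<le> ((16 ^ j * (17/16) ^ k) * (17 ^ j * (17/16) ^ k))\<^sup>2"
    by (intro power_mono) auto
  also have "\<dots> = ((16 * 17)\<^sup>2 * (17/16) ^ 128) ^ j * ((17/16) ^ 4) ^ r" by (rule split)
  \<comment> \<open>The first base is about 1.7 * 10^8, below 2^32, and the second is below 2; the
    ratio 32 between \<open>k\<close> and \<open>j\<close> leaves room for this.\<close>
  also have "\<dots> \<le> (2 ^ 32) ^ j * 2 ^ r"
    by (intro mult_mono power_mono) (simp_all add: power_divide)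
  also have "\<dots> = 2 ^ k" by (simp only: k power_add power_mult)
  finally have "real ((card {B. B \<subseteq> W \<and> card B \<le> j} * ((j + k) choose j))\<^sup>2) \<le> real (2 ^ k)"
    by simp
  then show ?thesis by (simp only: of_nat_le_iff)
qed

section \<open>The Erdos-Szemeredi exchange argument\<close>

lemma maximum_clique:
  assumes "finite S"
  shows "\<exists>W\<subseteq>S. homogeneous c b W \<and> (\<forall>A\<subseteq>S. homogeneous c b A \<longrightarrow> card A \<le> card W)"
proof -
  let ?\<A> = "{A. A \<subseteq> S \<and> homogeneous c b A}"
  have fin: "finite (card ` ?\<A>)" and ne: "{} \<in> ?\<A>"
    using assms by (auto simp: homogeneous_def)
  then have "Max (card ` ?\<A>) \<in> card ` ?\<A>" by (intro Max_in) auto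
  then obtain W where W: "W \<in> ?\<A>" "Max (card ` ?\<A>) = card W" by (rule imageE)
  moreover have "card A \<le> card W" if "A \<subseteq> S" "homogeneous c b A" for A
    using Max_ge[OF fin, of "card A"] that W(2) by auto
  ultimately show ?thesis by blast
qed

text \<open>Double counting of the pairs (v, w) of colour \<open>b\<close> with \<open>v\<close> in
  \<open>S\<close> and \<open>w\<close> in \<open>W\<close>: each \<open>v\<close> of the set lies
  in at least \<open>t\<close> of them, and each \<open>w\<close> in at most
  \<open>m\<close>.\<close>

lemma card_many_nbrs_le:
  assumes "finite S" "W \<subseteq> S" "card W \<le> k" "k < d * t"
    and "\<And>x. x \<in> S \<Longrightarrow> card (nbrs c b S x) \<le> m"
  shows "card {v \<in> S. t \<le> card (nbrs c b W v)} \<le> d * m"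
proof -
  let ?B = "{v \<in> S. t \<le> card (nbrs c b W v)}"
  have finW: "finite W" using assms(1,2) finite_subset by blast
  have "t * card ?B \<le> (\<Sum>v\<in>?B. card (nbrs c b W v))"
    using sum_mono[of ?B "\<lambda>_. t" "\<lambda>v. card (nbrs c b W v)"] by (simp add: mult.commute)
  also have "\<dots> \<le> (\<Sum>v\<in>S. card (nbrs c b W v))"
    using assms(1) by (intro sum_mono2) auto
  also have "\<dots> = (\<Sum>v\<in>S. card {w \<in> W. v \<noteq> w \<and> c {v, w} = b})"
    unfolding nbrs_def by (intro sum.cong refl arg_cong[where f = card]) auto
  also have "\<dots> = (\<Sum>w\<in>W. card {v \<in> S. v \<noteq> w \<and> c {v, w} = b})"
    by (rule sum_multicount_gen[OF assms(1) finW]) simp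
  also have "\<dots> \<le> (\<Sum>w\<in>W. m)"
  proof (rule sum_mono)
    fix w assume "w \<in> W"
    moreover have "{v \<in> S. v \<noteq> w \<and> c {v, w} = b} = nbrs c b S w"
      unfolding nbrs_def by (auto simp: insert_commute)
    ultimately show "card {v \<in> S. v \<noteq> w \<and> c {v, w} = b} \<le> m" using assms(2,5) by auto
  qed
  also have "\<dots> \<le> k * m" using assms(3) by simp
  also have "\<dots> \<le> t * (d * m)" using assms(4) mult_right_mono[of k "d * t" m] by (simp add: ac_simps)
  finally have "t * card ?B \<le> t * (d * m)" .
  moreover have "t > 0" using assms(4) by (cases t) auto
  ultimately show ?thesis by simp
qed

text \<open>If a maximum \<open>b\<close>-clique \<open>W\<close> has fewer than \<open>k\<close>
  vertices, the vertices outside it are classified by their neighbourhood \<open>B\<close> in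
  \<open>W\<close> in the other colour. In a large class, a \<open>b\<close>-clique with more
  vertices than \<open>B\<close> would contradict the maximality of \<open>W\<close>, so the class
  contains a clique of the other colour.\<close>

lemma clique_if_sparse_colour:
  assumes fin: "finite S" and deg: "\<And>x. x \<in> S \<Longrightarrow> card (nbrs c (\<not> b) S x) \<le> m"
    and m: "2 ^ k \<le> 4 * m\<^sup>2" "k \<le> m" and S: "35 * m \<le> card S"
  shows "(\<exists>A\<subseteq>S. card A = k \<and> homogeneous c b A) \<or>
         (\<exists>A\<subseteq>S. card A = Suc k \<and> homogeneous c (\<not> b) A)"
proof -
  obtain W where W: "W \<subseteq> S" "homogeneous c b W"
    "\<forall>A\<subseteq>S. homogeneous c b A \<longrightarrow> card A \<le> card W"
    using maximum_clique[OF fin, of c b] by blast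
  have finW: "finite W" using W(1) fin finite_subset by blast
  show ?thesis
  proof (cases "k \<le> card W")
    case True
    then obtain A where "A \<subseteq> W" "card A = k" using obtain_subset_with_card_n by metis
    then show ?thesis using W(1) homogeneous_subset[OF W(2)] by blast
  next
    case False
    then have Wk: "card W \<le> k" by simp
    define j where "j = k div 32"
    have j: "32 * j \<le> k" "k < 32 * Suc j" unfolding j_def by simp_all
    define many where "many = {v \<in> S. Suc j \<le> card (nbrs c (\<not> b) W v)}"
    define good where "good = S - W - many"
    define classes where "classes = {B. B \<subseteq> W \<and> card B \<le> j}"
    have "card many \<le> 32 * m"
      unfolding many_def by (rule card_many_nbrs_le[OF fin W(1) Wk j(2) deg])
    moreover have "card good \<ge> card S - card W - card many"
      unfolding good_def using diff_card_le_card_Diff[of many "S - W"] diff_card_le_card_Diff[of W S]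
        fin finW by (simp add: many_def)
    \<comment> \<open>This accounts for the constant 35: at most 32 m vertices have more than
      \<open>j\<close> neighbours of the other colour in \<open>W\<close>, at most k \<le> m lie in
      \<open>W\<close>, and 2 m remain.\<close>
    ultimately have g: "2 * m \<le> card good" using S Wk m(2) by linarith
    have fing: "finite good" unfolding good_def using fin by simp
    have cl: "finite classes" "{} \<in> classes" unfolding classes_def using finW by auto
    have "nbrs c (\<not> b) W \<in> good \<rightarrow> classes"
      unfolding good_def many_def classes_def by (auto simp: nbrs_def)
    moreover have "classes \<noteq> {}" using cl(2) by blast
    ultimately have
      "\<exists>B\<in>classes. card good \<le> card (nbrs c (\<not> b) W -` {B} \<inter> good) * card classes"
      using fing cl(1) by (intro pigeonhole_card)
    then obtain B where B: "B \<in> classes"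
      "card good \<le> card (nbrs c (\<not> b) W -` {B} \<inter> good) * card classes" ..
    define T where "T = nbrs c (\<not> b) W -` {B} \<inter> good"
    \<comment> \<open>The exponential lower bound on \<open>m\<close> enters here: 2 m good vertices
      suffice for some class to reach the size \<open>(j + k) choose j\<close>.\<close>
    have "(card classes * ((j + k) choose j))\<^sup>2 \<le> (2 * m)\<^sup>2"
      using small_subsets_choose_bound[OF finW Wk j(1)] m(1) unfolding classes_def
      by (simp add: power_mult_distrib)
    then have "card classes * ((j + k) choose j) \<le> 2 * m" by (rule power2_le_imp_le) simp
    then have "((j + k) choose j) * card classes \<le> 2 * m" by (simp only: mult.commute)
    also note g
    also note B(2)
    finally have "((j + k) choose j) * card classes \<le> card T * card classes"
      unfolding T_def .
    moreover have "card classes > 0" using cl card_gt_0_iff by blast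
    ultimately have "(j + k) choose j \<le> card T" by simp
    moreover have "finite T" unfolding T_def using fing by simp
    ultimately have "(\<exists>A\<subseteq>T. card A = Suc j \<and> homogeneous c b A) \<or>
        (\<exists>A\<subseteq>T. card A = Suc k \<and> homogeneous c (\<not> b) A)"
      by (intro ramsey_choose)
    then consider A where "A \<subseteq> T" "card A = Suc j" "homogeneous c b A"
      | A where "A \<subseteq> T" "card A = Suc k" "homogeneous c (\<not> b) A"
      by (elim disjE exE conjE)
    then show ?thesis
    proof cases
      case 1
      have AS: "A \<subseteq> S - W" using 1(1) unfolding T_def good_def by blast
      have sub: "(W - B) \<union> A \<subseteq> S" using AS W(1) by blast
      \<comment> \<open>The vertices of \<open>A\<close> have no neighbour of the other colour in
        \<open>W - B\<close>. The exchange removes at most \<open>j\<close> vertices from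
        \<open>W\<close> and adds \<open>Suc j\<close>.\<close>
      have "homogeneous c b ((W - B) \<union> A)"
      proof (rule homogeneous_Un[OF homogeneous_subset[OF W(2)] 1(3)])
        fix x y assume "x \<in> W - B" "y \<in> A" "x \<noteq> y"
        moreover from this have "nbrs c (\<not> b) W y = B" using 1(1) unfolding T_def by auto
        ultimately show "c {x, y} = b" unfolding nbrs_def by (auto simp: insert_commute)
      qed blast
      with W(3) sub have "card ((W - B) \<union> A) \<le> card W" by simp
      moreover have "card ((W - B) \<union> A) = card (W - B) + card A"
        using AS finW finite_subset[OF AS] fin by (intro card_Un_disjoint) auto
      moreover have "card (W - B) \<ge> card W - j"
      proof -
        have "B \<subseteq> W" "card B \<le> j" using B(1) unfolding classes_def by auto
        then show ?thesis using finite_subset[OF _ finW] by (simp add: card_Diff_subset)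
      qed
      ultimately show ?thesis using 1(2) by simp
    next
      case 2
      then show ?thesis unfolding T_def good_def by blast
    qed
  qed
qed

text \<open>In a colouring without the larger clique, the neighbourhood \<open>S\<close> of vertex 0
  in a frequent colour \<open>b\<close> contains no \<open>b\<close>-clique of size
  \<open>k\<close>. This keeps the degrees of the other colour inside \<open>S\<close> small, and
  the exchange argument applies.\<close>

lemma ramsey_number_complete_Suc_le:
  assumes "1 \<le> k"
  shows "ramsey_number (complete_graph (Suc k)) \<le> 71 * ramsey_number (complete_graph k)"
proof (rule ramsey_number_le)
  fix c
  define m where "m = ramsey_number (complete_graph k)"
  define V where "V = {..<71 * m}"
  have finV: "finite V" and cardV: "card V = 71 * m" unfolding V_def by simp_all
  have m: "2 ^ k \<le> 4 * m\<^sup>2" "k \<le> m"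
    unfolding m_def by (rule ramsey_number_complete_lower[OF assms] le_ramsey_number_complete)+
  have m0: "0 < m" using m(2) assms by linarith
  then have "0 \<in> V" unfolding V_def by simp
  \<comment> \<open>71 = 2 * 35 + 1, the last m \<ge> 1 paying for vertex 0 itself.\<close>
  obtain b where b: "35 * m \<le> card (nbrs c b V 0)"
  proof -
    have "35 * m \<le> card (nbrs c True V 0) \<or> 35 * m \<le> card (nbrs c (\<not> True) V 0)"
      using card_nbrs_both[OF finV \<open>0 \<in> V\<close>, of c True] cardV m0 by linarith
    then show thesis using that by blast
  qed
  define S where "S = nbrs c b V 0"
  have finS: "finite S" "S \<subseteq> V" unfolding S_def using finV by (auto simp: nbrs_def)
  have "\<exists>A\<subseteq>V. \<exists>col. card A = Suc k \<and> homogeneous c col A"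
  proof (rule ccontr)
    assume no: "\<not> ?thesis"
    have noS: "\<not> (\<exists>A\<subseteq>S. card A = k \<and> homogeneous c b A)"
    proof
      assume "\<exists>A\<subseteq>S. card A = k \<and> homogeneous c b A"
      then obtain A where "A \<subseteq> nbrs c b V 0" "card A = k" "homogeneous c b A"
        unfolding S_def by blast
      from extend_clique[OF finV \<open>0 \<in> V\<close> this] no show False by blast
    qed
    \<comment> \<open>A larger neighbourhood would contain a monochromatic clique of size
      \<open>k\<close>. Colour \<open>b\<close> is excluded by \<open>noS\<close>, and in the other
      colour \<open>x\<close> extends the clique.\<close>
    have deg: "card (nbrs c (\<not> b) S x) \<le> m" if x: "x \<in> S" for x
    proof (rule ccontr)
      assume "\<not> ?thesis"
      then have "ramsey_number (complete_graph k) \<le> card (nbrs c (\<not> b) S x)"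
        unfolding m_def by simp
      from complete_graph_ramsey_set[OF finite_nbrs[OF finS(1)] this, of c]
      obtain A col where A: "A \<subseteq> nbrs c (\<not> b) S x" "card A = k" "homogeneous c col A"
        by blast
      then have "A \<subseteq> S" using nbrs_subset by blast
      then have "col \<noteq> b" using A noS by blast
      then have "homogeneous c (\<not> b) A" using A(3) by (cases b; cases col) auto
      from extend_clique[OF finS(1) x A(1,2) this] no finS(2) show False by blast
    qed
    have "35 * m \<le> card S" using b unfolding S_def .
    from clique_if_sparse_colour[OF finS(1) deg m this] noS no finS(2) show False by blast
  qed
  then show "has_mono_copy (71 * ramsey_number (complete_graph k)) (complete_graph (Suc k)) c"
    unfolding has_mono_copy_complete_iff V_def m_def by blast
qed

section \<open>The star with a clique\<close>

text \<open>For 1 \<le> k \<le> n the hub 0 belongs to the clique \<open>{..<k}\<close>. The case k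
  = 1 is the star and k = n the complete graph.\<close>

definition star_clique :: "nat \<Rightarrow> nat \<Rightarrow> graph" where
  "star_clique n k = ({..<n},
     {e. \<exists>x y. x < n \<and> y < n \<and> x \<noteq> y \<and> (x = 0 \<or> x < k \<and> y < k) \<and> e = {x, y}})"

lemma verts_star_clique [simp]: "verts (star_clique n k) = {..<n}"
  by (simp add: verts_def star_clique_def)

lemma edges_star_clique_iff:
  "e \<in> edges (star_clique n k) \<longleftrightarrow>
     (\<exists>x y. x < n \<and> y < n \<and> x \<noteq> y \<and> (x = 0 \<or> x < k \<and> y < k) \<and> e = {x, y})"
  by (simp add: edges_def star_clique_def)

lemma connected_star_clique:
  assumes "1 \<le> n"
  shows "connected_graph (star_clique n k)"
proof -
  have adj: "(0, x) \<in> adj_rel (star_clique n k)" "(x, 0) \<in> adj_rel (star_clique n k)"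
    if "x < n" "x \<noteq> 0" for x
  proof -
    have "{0, x} \<in> edges (star_clique n k)"
      unfolding edges_star_clique_iff
      by (rule exI[of _ 0], rule exI[of _ x]) (use that in simp)
    then show "(0, x) \<in> adj_rel (star_clique n k)" "(x, 0) \<in> adj_rel (star_clique n k)"
      unfolding adj_rel_def by (simp_all add: insert_commute)
  qed
  have "(x, y) \<in> (adj_rel (star_clique n k))\<^sup>*" if "x < n" "y < n" for x y
  proof -
    have "(x, 0) \<in> (adj_rel (star_clique n k))\<^sup>*"
      using adj(2)[OF that(1)] by (cases "x = 0") auto
    moreover have "(0, y) \<in> (adj_rel (star_clique n k))\<^sup>*"
      using adj(1)[OF that(2)] by (cases "y = 0") auto
    ultimately show ?thesis by (rule rtrancl_trans)
  qed
  moreover have "is_graph (star_clique n k)"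
  proof -
    have "\<exists>x y. x \<noteq> y \<and> e = {x, y} \<and> x \<in> {..<n} \<and> y \<in> {..<n}"
      if "e \<in> edges (star_clique n k)" for e
      using that[unfolded edges_star_clique_iff] unfolding lessThan_iff by metis
    then show ?thesis unfolding is_graph_def by simp
  qed
  moreover have "verts (star_clique n k) \<noteq> {}" using assms by (simp add: lessThan_empty_iff)
  ultimately show ?thesis unfolding connected_graph_def by simp
qed

text \<open>\<open>v\<close> becomes the hub, \<open>A\<close> the clique, and further neighbours of
  \<open>v\<close> in colour \<open>b\<close> the leaves.\<close>

lemma has_mono_copy_star_cliqueI:
  assumes "1 \<le> k" "k \<le> n"
    and A: "A \<subseteq> {..<N}" "card A = k" "homogeneous c b A" and v: "v \<in> A"
    and deg: "n - 1 \<le> card (nbrs c b {..<N} v)"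
  shows "has_mono_copy N (star_clique n k) c"
proof -
  have finA: "finite A" using A(1) finite_subset by blast
  \<comment> \<open>As \<open>v\<close> is not its own neighbour, excluding \<open>A\<close> costs
    at most k - 1 of the n - 1 neighbours, which leaves enough for n - k leaves.\<close>
  have "card (nbrs c b {..<N} v - A) = card (nbrs c b {..<N} v - (A - {v}))"
    by (rule arg_cong[where f = card]) (auto simp: nbrs_def)
  also have "\<dots> \<ge> card (nbrs c b {..<N} v) - card (A - {v})"
    using finA by (intro diff_card_le_card_Diff) simp
  finally have "n - k \<le> card (nbrs c b {..<N} v - A)"
    using deg v A(2) finA assms(1) by simp
  then obtain L where L: "L \<subseteq> nbrs c b {..<N} v - A" "card L = n - k" "finite L"
    by (rule obtain_subset_with_card_n)
  obtain f where f: "bij_betw f {1..<k} (A - {v})"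
    using finite_same_card_bij[of "{1..<k}" "A - {v}"] finA A(2) v by auto
  obtain g where g: "bij_betw g {k..<n} L"
    using finite_same_card_bij[of "{k..<n}" L] L by auto
  define \<phi> where "\<phi> i = (if i = 0 then v else if i < k then f i else g i)" for i
  have "bij_betw \<phi> {0} {v}" unfolding \<phi>_def by (simp add: bij_betw_def)
  moreover have "bij_betw \<phi> {1..<k} (A - {v})"
    using f by (subst bij_betw_cong[of _ _ f]) (auto simp: \<phi>_def)
  ultimately have "bij_betw \<phi> ({0} \<union> {1..<k}) ({v} \<union> (A - {v}))"
    by (intro bij_betw_combine) auto
  moreover have "{0} \<union> {1..<k} = {..<k}" "{v} \<union> (A - {v}) = A" using assms(1) v by auto
  ultimately have bA: "bij_betw \<phi> {..<k} A" by simp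
  have bL: "bij_betw \<phi> {k..<n} L"
    using g assms(1) by (subst bij_betw_cong[of _ _ g]) (auto simp: \<phi>_def)
  have "bij_betw \<phi> ({..<k} \<union> {k..<n}) (A \<union> L)"
    using L(1) by (intro bij_betw_combine[OF bA bL]) auto
  moreover have "{..<k} \<union> {k..<n} = {..<n}" using assms(2) by auto
  ultimately have bij: "bij_betw \<phi> {..<n} (A \<union> L)" by simp
  have "A \<union> L \<subseteq> {..<N}" using A(1) L(1) nbrs_subset by blast
  moreover have "c (\<phi> ` e) = b" if "e \<in> edges (star_clique n k)" for e
  proof -
    from that[unfolded edges_star_clique_iff] obtain x y where xy: "x < n" "y < n" "x \<noteq> y"
      "x = 0 \<or> x < k \<and> y < k" "e = {x, y}" by blast
    have neq: "\<phi> x \<noteq> \<phi> y" using bij xy(1-3) unfolding bij_betw_def inj_on_def by auto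
    show ?thesis
    proof (cases "x < k \<and> y < k")
      case True
      then have "\<phi> x \<in> A" "\<phi> y \<in> A" using bA unfolding bij_betw_def by auto
      then show ?thesis using A(3) neq xy(5) unfolding homogeneous_def by simp
    next
      case False
      then have "x = 0" "k \<le> y" using xy(4) assms(1) by auto
      then have "\<phi> x = v" "\<phi> y \<in> L" using bL xy(2) unfolding bij_betw_def by (auto simp: \<phi>_def)
      then show ?thesis using L(1) xy(5) unfolding nbrs_def by auto
    qed
  qed
  ultimately show ?thesis
    unfolding has_mono_copy_def using bij by (intro exI[of _ \<phi>] exI[of _ b]) (simp add: bij_betw_def)
qed

section \<open>Upper bound for the Ramsey number of \<open>star_clique\<close>\<close>

text \<open>Greedy choice: discarding a vertex together with its neighbours of colour
  \<open>b\<close> uses up at most \<open>n\<close> vertices, and all that remain are joined to it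
  in the other colour.\<close>

lemma opposite_clique_if_small_degree:
  assumes "0 < n" "finite V" "\<And>x. x \<in> V \<Longrightarrow> card (nbrs c b V x) < n" "n * k \<le> card V"
  shows "\<exists>A\<subseteq>V. card A = k \<and> homogeneous c (\<not> b) A"
  using assms(2-)
proof (induction k arbitrary: V)
  case 0
  show ?case by (rule exI[of _ "{}"]) (simp add: homogeneous_def)
next
  case (Suc k)
  show ?case
  proof (cases "V = {}")
    case True
    then show ?thesis using Suc.prems(3) assms(1) by simp
  next
    case False
    then obtain v where v: "v \<in> V" by blast
    define V' where "V' = nbrs c (\<not> b) V v"
    have sub: "V' \<subseteq> V" unfolding V'_def using nbrs_subset by blast
    have finV': "finite V'" using sub Suc.prems(1) finite_subset by blast
    have "card V - 1 = card (nbrs c b V v) + card V'"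
      unfolding V'_def by (rule card_nbrs_both[OF Suc.prems(1) v, symmetric])
    then have "n * k \<le> card V'" using Suc.prems(2)[OF v] Suc.prems(3) by simp
    moreover have "card (nbrs c b V' x) < n" if "x \<in> V'" for x
    proof -
      have "nbrs c b V' x \<subseteq> nbrs c b V x" using sub by (auto simp: nbrs_def)
      then have "card (nbrs c b V' x) \<le> card (nbrs c b V x)"
        using card_mono[OF finite_nbrs[OF Suc.prems(1)]] by blast
      then show ?thesis using Suc.prems(2)[of x] that sub by fastforce
    qed
    ultimately obtain A where "A \<subseteq> V'" "card A = k" "homogeneous c (\<not> b) A"
      using Suc.IH[OF finV'] by blast
    from extend_clique[OF Suc.prems(1) v this[unfolded V'_def]] show ?thesis .
  qed
qed

text \<open>\<open>U b\<close> collects the vertices of the \<open>b\<close>-cliques of size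
  \<open>k\<close>. Without a monochromatic copy both sets have fewer than n * k elements, so at
  least R(K_k) vertices lie outside them; a monochromatic clique among these is absurd.\<close>

lemma has_mono_copy_star_clique:
  assumes "1 \<le> k" "k \<le> n"
  shows "has_mono_copy (ramsey_number (complete_graph k) + 2 * n * k) (star_clique n k) c"
proof (rule ccontr)
  define m where "m = ramsey_number (complete_graph k)"
  define N where "N = m + 2 * n * k"
  assume "\<not> ?thesis"
  then have no: "\<not> has_mono_copy N (star_clique n k) c" unfolding N_def m_def .
  define U where "U b = {v. \<exists>A. A \<subseteq> {..<N} \<and> card A = k \<and> homogeneous c b A \<and> v \<in> A}" for b
  have U_sub: "U b \<subseteq> {..<N}" for b unfolding U_def by blast
  have finU: "finite (U b)" for b using U_sub finite_subset by blast
  have deg: "card (nbrs c b {..<N} v) < n - 1" if v: "v \<in> U b" for v b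
  proof (rule ccontr)
    assume "\<not> ?thesis"
    then have d: "n - 1 \<le> card (nbrs c b {..<N} v)" by simp
    from v obtain A where "A \<subseteq> {..<N}" "card A = k" "homogeneous c b A" "v \<in> A"
      unfolding U_def by blast
    from has_mono_copy_star_cliqueI[OF assms this d] no show False by blast
  qed
  \<comment> \<open>A vertex in both sets would have small degree in both colours, but the degrees
    add up to N - 1.\<close>
  have disj: "v \<notin> U (\<not> b)" if v: "v \<in> U b" for v b
  proof
    assume "v \<in> U (\<not> b)"
    from deg[OF this] deg[OF v] have "card (nbrs c b {..<N} v) + card (nbrs c (\<not> b) {..<N} v) < 2 * n - 1"
      by linarith
    moreover have "card (nbrs c b {..<N} v) + card (nbrs c (\<not> b) {..<N} v) = N - 1"
      using card_nbrs_both[of "{..<N}" v c b] v U_sub by auto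
    moreover have "2 * n * 1 \<le> 2 * n * k" using assms(1) by (intro mult_left_mono) auto
    ultimately show False unfolding N_def by linarith
  qed
  \<comment> \<open>A large \<open>U b\<close> would contain a clique of the other colour by greedy
    choice, and the vertices of that clique would lie in both sets.\<close>
  have small: "card (U b) < n * k" for b
  proof (rule ccontr)
    assume "\<not> ?thesis"
    then have large: "n * k \<le> card (U b)" by simp
    have n: "0 < n" using assms by simp
    have "card (nbrs c b (U b) x) < n" if "x \<in> U b" for x
    proof -
      have "nbrs c b (U b) x \<subseteq> nbrs c b {..<N} x" using U_sub by (auto simp: nbrs_def)
      then have "card (nbrs c b (U b) x) \<le> card (nbrs c b {..<N} x)"
        by (rule card_mono[OF finite_nbrs[OF finite_lessThan]])
      then show ?thesis using deg[OF that] by linarith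
    qed
    from opposite_clique_if_small_degree[OF n finU this large]
    obtain A where A: "A \<subseteq> U b" "card A = k" "homogeneous c (\<not> b) A" by blast
    from A(2) assms(1) obtain v where "v \<in> A" by fastforce
    moreover from this A U_sub[of b] have "v \<in> U (\<not> b)" unfolding U_def[of "\<not> b"] by blast
    ultimately show False using disj A(1) by blast
  qed
  define R where "R = {..<N} - (U True \<union> U False)"
  have "card (U True \<union> U False) < 2 * n * k"
    using card_Un_le[of "U True" "U False"] small[of True] small[of False] by simp
  moreover have "N - card (U True \<union> U False) \<le> card R"
    unfolding R_def using diff_card_le_card_Diff[of "U True \<union> U False" "{..<N}"] finU by simp
  ultimately have "ramsey_number (complete_graph k) \<le> card R" unfolding N_def m_def by linarith
  moreover have "finite R" unfolding R_def by simp
  ultimately obtain A b where A: "A \<subseteq> R" "card A = k" "homogeneous c b A"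
    using complete_graph_ramsey_set[of R k c] by blast
  from A(2) assms(1) obtain v where v: "v \<in> A" by fastforce
  have "A \<subseteq> {..<N}" using A(1) unfolding R_def by blast
  then have "v \<in> U b" using A v unfolding U_def by blast
  then have "v \<in> U True \<union> U False" by (cases b) auto
  then show False using A(1) v unfolding R_def by blast
qed

lemma star_clique_ramsey:
  assumes "1 \<le> k" "k \<le> n"
  shows "has_mono_copy (ramsey_number (star_clique n k)) (star_clique n k) c"
  by (rule ramsey_number_has_mono_copy[OF has_mono_copy_star_clique[OF assms]])

section \<open>Lower bounds for the Ramsey number of \<open>star_clique\<close>\<close>

lemma ramsey_number_complete_le_star_clique:
  assumes "1 \<le> k" "k \<le> n"
  shows "ramsey_number (complete_graph k) \<le> ramsey_number (star_clique n k)"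
proof (rule ramsey_number_le)
  fix c :: "nat set \<Rightarrow> bool"
  obtain \<phi> col where p: "inj_on \<phi> {..<n}" "\<phi> ` {..<n} \<subseteq> {..<ramsey_number (star_clique n k)}"
    "\<forall>e\<in>edges (star_clique n k). c (\<phi> ` e) = col"
    using star_clique_ramsey[OF assms, of c] unfolding has_mono_copy_def by auto
  have sub: "{..<k} \<subseteq> {..<n}" using assms(2) by auto
  have "edges (complete_graph k) \<subseteq> edges (star_clique n k)"
  proof
    fix e assume "e \<in> edges (complete_graph k)"
    then have "\<exists>x y. x < k \<and> y < k \<and> x \<noteq> y \<and> e = {x, y}"
      by (simp add: edges_def complete_graph_def)
    then obtain x y where "x < k" "y < k" "x \<noteq> y" "e = {x, y}" by (elim exE conjE)
    with assms(2) have "x < n \<and> y < n \<and> x \<noteq> y \<and> (x = 0 \<or> x < k \<and> y < k) \<and> e = {x, y}" by simp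
    then show "e \<in> edges (star_clique n k)" unfolding edges_star_clique_iff by (intro exI)
  qed
  with p(3) have "\<forall>e\<in>edges (complete_graph k). c (\<phi> ` e) = col" by blast
  moreover have "inj_on \<phi> {..<k}" by (rule inj_on_subset[OF p(1) sub])
  moreover have "\<phi> ` {..<k} \<subseteq> {..<ramsey_number (star_clique n k)}" by (rule subset_trans[OF image_mono[OF sub] p(2)])
  moreover have "verts (complete_graph k) = {..<k}" by (simp add: verts_def complete_graph_def)
  ultimately show "has_mono_copy (ramsey_number (star_clique n k)) (complete_graph k) c"
    unfolding has_mono_copy_def by (intro exI[of _ \<phi>], intro exI[of _ col]) simp
qed

text \<open>Guarantees that the search for a suitable \<open>k\<close> ends at k = n at the
  latest.\<close>

lemma ramsey_number_star_clique_full: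
  "ramsey_number (star_clique n n) = ramsey_number (complete_graph n)"
proof -
  have "star_clique n n = complete_graph n"
    unfolding star_clique_def complete_graph_def by auto
  then show ?thesis by simp
qed

text \<open>Split the vertices into k-1 blocks of size n-1: the connected graph does not fit inside a block,
  and the edges between blocks contain no k-clique.\<close>
lemma ramsey_number_star_clique_lower:
  assumes "1 \<le> k" "k \<le> n"
  shows "(k - 1) * (n - 1) < ramsey_number (star_clique n k)"
proof (rule ccontr)
  assume "\<not> ?thesis"
  then have N: "ramsey_number (star_clique n k) \<le> (k - 1) * (n - 1)" by simp
  \<comment> \<open>The blocks are the fibres of division by n - 1; colour \<open>True\<close> marks
    the edges inside a block.\<close>
  define c where "c e = (\<exists>q. \<forall>x\<in>e. x div (n - 1) = q)" for e :: "nat set"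
  have c: "c {x, y} \<longleftrightarrow> x div (n - 1) = y div (n - 1)" for x y
    unfolding c_def by auto
  obtain \<phi> col where p: "inj_on \<phi> {..<n}" "\<phi> ` {..<n} \<subseteq> {..<ramsey_number (star_clique n k)}"
    and e: "\<And>e. e \<in> edges (star_clique n k) \<Longrightarrow> c (\<phi> ` e) = col"
    using star_clique_ramsey[OF assms, of c] unfolding has_mono_copy_def by auto
  have r: "\<phi> x < (k - 1) * (n - 1)" if "x < n" for x
    using p(2) that N by (meson image_subset_iff lessThan_iff less_le_trans)
  \<comment> \<open>For n = 1 the assumed bound would leave no place for the vertex
    \<open>\<phi> 0\<close>.\<close>
  then have n1: "0 < n - 1" using assms r[of 0] by (cases "n - 1") auto
  have edge: "(\<phi> x div (n - 1) = \<phi> y div (n - 1)) = col"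
    if "x < n" "y < n" "x \<noteq> y" "x = 0 \<or> x < k \<and> y < k" for x y
  proof -
    have "{x, y} \<in> edges (star_clique n k)" using that unfolding edges_star_clique_iff by blast
    from e[OF this] show ?thesis using c[of "\<phi> x" "\<phi> y"] by simp
  qed
  show False
  proof (cases col)
    case True
    define q where "q = \<phi> 0 div (n - 1)"
    have "\<phi> x \<in> {q * (n - 1)..<q * (n - 1) + (n - 1)}" if "x < n" for x
    proof -
      have "\<phi> x div (n - 1) = q"
        using edge[of 0 x] that True unfolding q_def by (cases "x = 0") auto
      then have "q * (n - 1) + \<phi> x mod (n - 1) = \<phi> x"
        using div_mult_mod_eq[of "\<phi> x" "n - 1"] by simp
      moreover have "\<phi> x mod (n - 1) < n - 1" by (rule mod_less_divisor[OF n1])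
      ultimately show ?thesis unfolding atLeastLessThan_iff by linarith
    qed
    then have "\<phi> ` {..<n} \<subseteq> {q * (n - 1)..<q * (n - 1) + (n - 1)}" by blast
    then have "card (\<phi> ` {..<n}) \<le> n - 1"
      using card_mono[of "{q * (n - 1)..<q * (n - 1) + (n - 1)}"] by fastforce
    then show False using card_image[OF p(1)] n1 by simp
  next
    case False
    have "inj_on (\<lambda>x. \<phi> x div (n - 1)) {..<k}"
    proof (rule inj_onI, rule ccontr)
      fix x y assume "x \<in> {..<k}" "y \<in> {..<k}" "\<phi> x div (n - 1) = \<phi> y div (n - 1)" "x \<noteq> y"
      then show False using edge[of x y] False assms(2) by auto
    qed
    moreover have "(\<lambda>x. \<phi> x div (n - 1)) ` {..<k} \<subseteq> {..<k - 1}"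
      using r assms(2) by (auto simp: less_mult_imp_div_less)
    ultimately have "k \<le> k - 1" using card_inj_on_le[of _ "{..<k}" "{..<k - 1}"] by fastforce
    then show False using assms(1) by simp
  qed
qed

section \<open>Choice of the clique size\<close>

text \<open>Discrete continuity: for the least \<open>k\<close> that reaches \<open>t\<close>, the
  predecessor j = k - 1 stays below \<open>t\<close>, and the lower bounds at \<open>j\<close>
  control the upper bound at \<open>k\<close>.\<close>

lemma exists_star_clique_ramsey_between:
  assumes n: "2 \<le> n" and t: "n \<le> t" "t \<le> ramsey_number (complete_graph n)"
  shows "\<exists>k. t \<le> ramsey_number (star_clique n k) \<and> ramsey_number (star_clique n k) \<le> 83 * t"
proof -
  let ?r = "\<lambda>k. ramsey_number (star_clique n k)" and ?R = "\<lambda>k. ramsey_number (complete_graph k)"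
  define k where "k = (LEAST k. 1 \<le> k \<and> t \<le> ?r k)"
  have ex: "1 \<le> n \<and> t \<le> ?r n" using n t(2) ramsey_number_star_clique_full by simp
  have k: "1 \<le> k" "t \<le> ?r k" "k \<le> n"
    using LeastI[of "\<lambda>k. 1 \<le> k \<and> t \<le> ?r k", OF ex] Least_le[of "\<lambda>k. 1 \<le> k \<and> t \<le> ?r k", OF ex]
    unfolding k_def by blast+
  have up: "?r k \<le> ?R k + 2 * n * k"
    by (rule ramsey_number_le[OF has_mono_copy_star_clique[OF k(1,3)]])
  \<comment> \<open>83 = 71 + 2 * 6, from R(K_k) \<le> 71 t and n k \<le> 6 t. For k = 1 there is no
    predecessor, but the upper bound is at most 1 + 2 n \<le> 3 t.\<close>
  have "?r k \<le> 83 * t"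
  proof (cases "k = 1")
    case True
    have "?R 1 \<le> 1"
      by (rule ramsey_number_le) (auto simp: has_mono_copy_complete_iff homogeneous_def intro!: exI[of _ "{0}"])
    then show ?thesis using up True n t(1) by simp
  next
    case False
    define j where "j = k - 1"
    have j: "k = Suc j" "1 \<le> j" "j \<le> n" using False k(1,3) unfolding j_def by auto
    have "?r j < t"
      using not_less_Least[of j "\<lambda>k. 1 \<le> k \<and> t \<le> ?r k"] j(1,2) unfolding k_def[symmetric] by auto
    moreover have "?R j \<le> ?r j" by (rule ramsey_number_complete_le_star_clique[OF j(2,3)])
    moreover have "(j - 1) * (n - 1) < ?r j" by (rule ramsey_number_star_clique_lower[OF j(2,3)])
    ultimately have lower: "?R j < t" "(j - 1) * (n - 1) < t" by linarith+
    \<comment> \<open>For j = 1 the lower bound (j - 1) * (n - 1) vanishes and n k = 2 n \<le> 2 t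
      serves instead. Otherwise n \<le> 2 (n - 1) and j + 1 \<le> 3 (j - 1).\<close>
    have "n * k \<le> 6 * t"
    proof (cases "j = 1")
      case True
      then show ?thesis using t(1) j(1) by simp
    next
      case False
      have "n * k \<le> (2 * (n - 1)) * (3 * (j - 1))"
        using n j False by (intro mult_le_mono) auto
      also have "\<dots> = 6 * ((j - 1) * (n - 1))" by simp
      finally show ?thesis using lower(2) by linarith
    qed
    moreover have "?R k \<le> 71 * ?R j" unfolding j(1) by (rule ramsey_number_complete_Suc_le[OF j(2)])
    ultimately show ?thesis using up lower(1) by (simp add: mult.assoc)
  qed
  then show ?thesis using k(2) by blast
qed

theorem theorem1p1:
  shows "\<exists>(C::real) (n0::nat). C > 0 \<and> n0 > 0 \<and>
    (\<forall>f :: nat \<Rightarrow> nat.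
       (\<forall>m n. 1 \<le> m \<longrightarrow> m \<le> n \<longrightarrow> f m \<le> f n) \<longrightarrow>
       (\<forall>n\<ge>1. n \<le> f n \<and> f n \<le> ramsey_number (complete_graph n)) \<longrightarrow>
       (\<exists>G :: nat \<Rightarrow> graph.
          (\<forall>n\<ge>1. connected_graph (G n)) \<and>
          (\<forall>n\<ge>n0. card (verts (G n)) = n \<and>
                   real (f n) \<le> real (ramsey_number (G n)) \<and>
                   real (ramsey_number (G n)) \<le> C * real (f n))))"
proof (rule exI[of _ "83::real"], rule exI[of _ "2::nat"], intro conjI allI impI)
  fix f :: "nat \<Rightarrow> nat"
  assume f: "\<forall>n\<ge>1. n \<le> f n \<and> f n \<le> ramsey_number (complete_graph n)"
  \<comment> \<open>For n < 2 the value \<open>K n\<close> is left unspecified. The graph at n = 1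
    is connected all the same, because connectedness of \<open>star_clique n k\<close> holds for
    every \<open>k\<close>.\<close>
  have "\<forall>n. \<exists>k. 2 \<le> n \<longrightarrow> f n \<le> ramsey_number (star_clique n k) \<and>
      ramsey_number (star_clique n k) \<le> 83 * f n"
    using exists_star_clique_ramsey_between f by auto
  then obtain K where K: "\<And>n. 2 \<le> n \<Longrightarrow> f n \<le> ramsey_number (star_clique n (K n)) \<and>
      ramsey_number (star_clique n (K n)) \<le> 83 * f n"
    by metis
  have "real (ramsey_number (star_clique n (K n))) \<le> 83 * real (f n)" if "2 \<le> n" for n
    using K[OF that] by linarith
  with K show "\<exists>G. (\<forall>n\<ge>1. connected_graph (G n)) \<and>
          (\<forall>n\<ge>2. card (verts (G n)) = n \<and>
                   real (f n) \<le> real (ramsey_number (G n)) \<and>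
                   real (ramsey_number (G n)) \<le> 83 * real (f n))"
    by (intro exI[of _ "\<lambda>n. star_clique n (K n)"]) (simp add: connected_star_clique)
qed auto

end
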